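(* The independence number is stable under 2-switch: for every graph $G$ and every 2-switch $\tau$, $|\alpha(\tau(G))-\alpha(G)|\le 1$.
   Context: Graphs are finite, simple, undirected and labeled. $\alpha(G)$ is the maximum cardinality of a set of pairwise non-adjacent vertices of $G$. For vertices $a,b,c,d$, the 2-switch $\tau=\binom{a\ b}{c\ d}$ maps $G$ to $G-ab-cd+ac+bd$ if $ab,cd\in E(G)$, $\{a,b\}\cap\{c,d\}=\varnothing$ and $ac,bd\notin E(G)$, and to $G$ otherwise. *)

theory Defs
  imports "Graph_Theory.Pair_Digraph"
begin

text \<open>
  A finite simple undirected graph is a \<^const>\<open>pair_graph\<close>: finite vertex and arc sets, no loops,
  symmetric arcs. The undirected edge \<open>uv\<close> is the pair of arcs \<open>(u, v)\<close>, \<open>(v, u)\<close>, so adding or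
  deleting an edge means adding or deleting both arcs.
\<close>

definition two_switch :: "'a \<Rightarrow> 'a \<Rightarrow> 'a \<Rightarrow> 'a \<Rightarrow> 'a pair_pre_digraph \<Rightarrow> 'a pair_pre_digraph" where
  "two_switch a b c d G =
    (if (a, b) \<in> parcs G \<and> (c, d) \<in> parcs G \<and> {a, b} \<inter> {c, d} = {}
        \<and> (a, c) \<notin> parcs G \<and> (b, d) \<notin> parcs G
     then \<lparr> pverts = pverts G,
            parcs = (parcs G - {(a, b), (b, a), (c, d), (d, c)})
                      \<union> {(a, c), (c, a), (b, d), (d, b)} \<rparr>
     else G)"

definition independent_set :: "'a pair_pre_digraph \<Rightarrow> 'a set \<Rightarrow> bool" where
  "independent_set G S \<longleftrightarrow> S \<subseteq> pverts G \<and> pairwise (\<lambda>u v. (u, v) \<notin> parcs G) S"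

definition independence_number :: "'a pair_pre_digraph \<Rightarrow> nat" where
  "independence_number G = Max (card ` {S. independent_set G S})"

lemma pair_graph_two_switch:
  assumes "pair_graph G"
  shows "pair_graph (two_switch a b c d G)"
proof -
  interpret pair_graph G by fact
  show ?thesis
  proof (cases "(a, b) \<in> parcs G \<and> (c, d) \<in> parcs G \<and> {a, b} \<inter> {c, d} = {}
      \<and> (a, c) \<notin> parcs G \<and> (b, d) \<notin> parcs G")
    case True
    let ?H = "two_switch a b c d G"
    have H: "pverts ?H = pverts G"
      "parcs ?H = (parcs G - {(a, b), (b, a), (c, d), (d, c)}) \<union> {(a, c), (c, a), (b, d), (d, b)}"
      using True by (simp_all add: two_switch_def)
    have V: "a \<in> pverts G" "b \<in> pverts G" "c \<in> pverts G" "d \<in> pverts G"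
      using True wellformed' by blast+
    show ?thesis
    proof
      fix e assume "e \<in> parcs ?H"
      then show "fst e \<in> pverts ?H" "snd e \<in> pverts ?H" "fst e \<noteq> snd e"
        using V True arc_fst_in_verts[of e] arc_snd_in_verts[of e] pair_no_loops[of e]
        unfolding H by auto
    next
      show "finite (pverts ?H)" "finite (parcs ?H)"
        unfolding H using pair_finite_verts pair_finite_arcs by auto
    next
      have "sym (parcs ?H)"
        unfolding H by (rule symI) (auto dest: arcs_symmetric)
      then show "symmetric (with_proj ?H)"
        by (simp add: symmetric_def)
    qed
  next
    case False
    then have "two_switch a b c d G = G"
      unfolding two_switch_def by (rule if_not_P)
    then show ?thesis using assms by simp
  qed
qed

lemma independent_sets_finite_nonempty:
  assumes "pair_graph G"
  shows "finite {S. independent_set G S}" and "{S. independent_set G S} \<noteq> {}"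
proof -
  interpret pair_graph G by fact
  have "{S. independent_set G S} \<subseteq> Pow (pverts G)"
    by (auto simp: independent_set_def)
  then show "finite {S. independent_set G S}"
    using pair_finite_verts finite_subset by blast
  have "independent_set G {}"
    by (simp add: independent_set_def)
  then show "{S. independent_set G S} \<noteq> {}" by blast
qed

end

theory Submission
  imports Defs
begin

text \<open>
  An independent set of \<open>G\<close> contains at most one of \<open>a, b\<close> and at most one of \<open>c, d\<close>, hence at most one
  of the two edges \<open>ac, bd\<close> created by the switch; deleting one vertex of it makes the set
  independent in the switched graph. The converse inequality holds because a nontrivial 2-switch
  is undone by another 2-switch.
\<close>

lemma card_le_independence_number:
  assumes "pair_graph G" "independent_set G S"
  shows "card S \<le> independence_number G"
  unfolding independence_number_def
  using assms independent_sets_finite_nonempty(1)[OF assms(1)] by (intro Max_ge) auto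

lemma independence_number_attained:
  assumes "pair_graph G"
  obtains S where "independent_set G S" "card S = independence_number G"
proof -
  have "independence_number G \<in> card ` {S. independent_set G S}"
    unfolding independence_number_def
    using independent_sets_finite_nonempty[OF assms] by (intro Max_in) auto
  then show thesis using that by auto
qed

lemma independent_set_two_switch_Diff:
  assumes "independent_set G S"
  obtains v where "independent_set (two_switch a b c d G) (S - {v})"
proof -
  \<comment> \<open>If both ends of the new edge \<open>ac\<close> lie in \<open>S\<close>, deleting
    \<open>a\<close> suffices: in a nontrivial switch \<open>ab\<close> is an edge of
    \<open>G\<close>, so \<open>b\<close> is not in \<open>S - {a}\<close> and \<open>bd\<close>
    does no harm. Otherwise only \<open>bd\<close> can violate independence, and deleting
    \<open>b\<close> removes it.\<close>
  define v where "v = (if a \<in> S \<and> c \<in> S then a else b)"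
  have "independent_set (two_switch a b c d G) (S - {v})"
    using assms unfolding independent_set_def two_switch_def pairwise_def v_def by auto
  then show thesis by (rule that)
qed

lemma independence_number_le_two_switch:
  assumes "pair_graph G"
  shows "independence_number G \<le> independence_number (two_switch a b c d G) + 1"
proof -
  obtain S where S: "independent_set G S" "card S = independence_number G"
    using independence_number_attained[OF assms] .
  obtain v where v: "independent_set (two_switch a b c d G) (S - {v})"
    using independent_set_two_switch_Diff[OF S(1)] .
  \<comment> \<open>The vertex \<open>v\<close> may lie outside \<open>S\<close>, in which case
    nothing is lost.\<close>
  have "card S \<le> card (S - {v}) + 1"
    using card_Diff1_le[of S v] by (cases "v \<in> S") (auto simp: card_Diff_singleton)
  then show ?thesis
    using card_le_independence_number[OF pair_graph_two_switch[OF assms] v] S(2) by linarith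
qed

text \<open>Exchanging the roles of \<open>b\<close> and \<open>c\<close> swaps the deleted pair of
  edges with the added pair.\<close>

lemma two_switch_inverse:
  assumes "pair_graph G"
    and "(a, b) \<in> parcs G" "(c, d) \<in> parcs G" "{a, b} \<inter> {c, d} = {}"
    and "(a, c) \<notin> parcs G" "(b, d) \<notin> parcs G"
  shows "two_switch a c b d (two_switch a b c d G) = G"
proof -
  interpret pair_graph G by fact
  \<comment> \<open>Together with the assumed disjointness this gives
    \<open>{a, c} \<inter> {b, d} = {}\<close>, which the second switch requires in order to be
    nontrivial.\<close>
  have "a \<noteq> b" "c \<noteq> d"
    using assms(2,3) no_loops' by blast+
  \<comment> \<open>The reverse arcs matter too: those put back were in \<open>G\<close>, and those
    taken away were not.\<close>
  moreover have "(b, a) \<in> parcs G" "(d, c) \<in> parcs G" "(c, a) \<notin> parcs G" "(d, b) \<notin> parcs G"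
    using assms arcs_symmetric by blast+
  ultimately show ?thesis
    using assms(2-) unfolding two_switch_def by (intro pair_pre_digraph.equality) auto
qed

theorem theorem10:
  fixes G :: "'a pair_pre_digraph" and a b c d :: 'a
  assumes "pair_graph G"
  shows "\<bar>int (independence_number (two_switch a b c d G)) - int (independence_number G)\<bar> \<le> 1"
proof (cases "(a, b) \<in> parcs G \<and> (c, d) \<in> parcs G \<and> {a, b} \<inter> {c, d} = {}
    \<and> (a, c) \<notin> parcs G \<and> (b, d) \<notin> parcs G")
  case True
  then have "two_switch a c b d (two_switch a b c d G) = G"
    using two_switch_inverse[OF assms] by blast
  \<comment> \<open>The one-sided bound is applied to the switched graph with the inverse
    switch.\<close>
  then have "independence_number (two_switch a b c d G) \<le> independence_number G + 1"
    using independence_number_le_two_switch[OF pair_graph_two_switch[OF assms]] by metis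
  then show ?thesis
    using independence_number_le_two_switch[OF assms, of a b c d] by linarith
next
  case False
  then have "two_switch a b c d G = G"
    unfolding two_switch_def by (rule if_not_P)
  then show ?thesis by simp
qed

end
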